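(* Let $v\neq0$ and $c_2$ be real numbers and let $a_1>0$, $m_0>0$. For $x\in\mathbb{R}$ put $$EI(x)=a_1e^{-vx},\qquad m(x)=m_0\,e^{v\left(-4c_2e^{-vx}-5x\right)},\qquad T(x)=2a_1v^2e^{-vx}.$$ Then for all real constants $A_1,A_2$ the function $$u(x,t)=e^{2vx}(A_1+A_2t)$$ satisfies, for all $x,t\in\mathbb{R}$, $$\frac{\partial^2}{\partial x^2}\left(EI(x)\frac{\partial^2u}{\partial x^2}\right)+m(x)\frac{\partial^2u}{\partial t^2}-\frac{\partial}{\partial x}\left(T(x)\frac{\partial u}{\partial x}\right)=0.$$
   Context: $EI(x)$ is a single function symbol (bending stiffness), $m(x)$ is the mass per unit length, and $T(x)$ is the axial load of an Euler–Bernoulli beam. The stiffness and mass functions are assumed positive. *)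

theory Defs
  imports "HOL-Analysis.Analysis"
begin

definition partial_x :: "(real \<Rightarrow> real \<Rightarrow> real) \<Rightarrow> real \<Rightarrow> real \<Rightarrow> real" where
  "partial_x u x t = deriv (\<lambda>y. u y t) x"

definition partial_t :: "(real \<Rightarrow> real \<Rightarrow> real) \<Rightarrow> real \<Rightarrow> real \<Rightarrow> real" where
  "partial_t u x t = deriv (\<lambda>s. u x s) t"

(* deriv is unspecified at points of non-differentiability, so the existence of every
   derivative occurring in the equation is required separately. *)

definition has_partial_x :: "(real \<Rightarrow> real \<Rightarrow> real) \<Rightarrow> bool" where
  "has_partial_x u \<longleftrightarrow> (\<forall>x t. (\<lambda>y. u y t) differentiable (at x))"

definition has_partial_t :: "(real \<Rightarrow> real \<Rightarrow> real) \<Rightarrow> bool" where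
  "has_partial_t u \<longleftrightarrow> (\<forall>x t. (\<lambda>s. u x s) differentiable (at t))"

definition beam_derivatives_exist ::
  "(real \<Rightarrow> real) \<Rightarrow> (real \<Rightarrow> real) \<Rightarrow> (real \<Rightarrow> real \<Rightarrow> real) \<Rightarrow> bool" where
  "beam_derivatives_exist EI T u \<longleftrightarrow>
     has_partial_x u \<and> has_partial_x (partial_x u) \<and>
     has_partial_x (\<lambda>x t. EI x * partial_x (partial_x u) x t) \<and>
     has_partial_x (partial_x (\<lambda>x t. EI x * partial_x (partial_x u) x t)) \<and>
     has_partial_t u \<and> has_partial_t (partial_t u) \<and>
     has_partial_x (\<lambda>x t. T x * partial_x u x t)"

definition solves_beam_equation ::
  "(real \<Rightarrow> real) \<Rightarrow> (real \<Rightarrow> real) \<Rightarrow> (real \<Rightarrow> real) \<Rightarrow> (real \<Rightarrow> real \<Rightarrow> real) \<Rightarrow> bool" where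
  "solves_beam_equation EI m T u \<longleftrightarrow>
     beam_derivatives_exist EI T u \<and>
     (\<forall>x t. partial_x (partial_x (\<lambda>x t. EI x * partial_x (partial_x u) x t)) x t
            + m x * partial_t (partial_t u) x t
            - partial_x (\<lambda>x t. T x * partial_x u x t) x t = 0)"

end

theory Submission
  imports Defs
begin

text \<open>
  On a separated function \<open>exp (k x) g(t)\<close> the operator \<open>\<partial>/\<partial>x\<close> is multiplication by \<open>k\<close>, and
  multiplication by \<open>exp (- v x)\<close> shifts the rate \<open>k\<close> to \<open>k - v\<close>.  Here \<open>u\<close> has rate \<open>2 v\<close> and is
  affine in \<open>t\<close>.  So the inertia term vanishes, while the bending
  term and the axial term are both equal to \<open>4 a\<^sub>1 v\<^sup>4 exp (v x) (A\<^sub>1 + A\<^sub>2 t)\<close>: the first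
  collects \<open>(2 v)\<^sup>2\<close> before the shift to the rate \<open>v\<close> and \<open>v\<^sup>2\<close> after it, the second the factor
  \<open>2 v\<^sup>2\<close> of \<open>T\<close>, then \<open>2 v\<close> before the shift and \<open>v\<close> after it.
\<close>

lemma has_real_derivative_exp_times_const:
  "((\<lambda>y. exp (k * y) * c) has_real_derivative exp (k * x) * (k * c)) (at x)"
  by (auto intro!: derivative_eq_intros)

lemma partial_x_exp:
  "partial_x (\<lambda>x t. exp (k * x) * g t) = (\<lambda>x t. exp (k * x) * (k * g t))"
  unfolding partial_x_def
  by (intro ext DERIV_imp_deriv has_real_derivative_exp_times_const)

lemma has_partial_x_exp: "has_partial_x (\<lambda>x t. exp (k * x) * g t)"
  unfolding has_partial_x_def
  using has_real_derivative_exp_times_const real_differentiable_def by blast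

lemma has_real_derivative_times_affine:
  "((\<lambda>s. c * (A + B * s)) has_real_derivative c * B) (at (t :: real))"
  by (auto intro!: derivative_eq_intros)

lemma partial_t_affine:
  "partial_t (\<lambda>x t. f x * (A + B * t)) = (\<lambda>x t. f x * B)"
  unfolding partial_t_def
  by (intro ext DERIV_imp_deriv has_real_derivative_times_affine)

lemma has_partial_t_affine: "has_partial_t (\<lambda>x t. f x * (A + B * t))"
  unfolding has_partial_t_def
  using has_real_derivative_times_affine real_differentiable_def by blast

theorem mainTheorem2:
  fixes v c\<^sub>2 a\<^sub>1 m\<^sub>0 A\<^sub>1 A\<^sub>2 :: real
    and EI m T :: "real \<Rightarrow> real"
    and u :: "real \<Rightarrow> real \<Rightarrow> real"
  assumes "v \<noteq> 0" and "a\<^sub>1 > 0" and "m\<^sub>0 > 0"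
    and "\<And>x. EI x = a\<^sub>1 * exp (- v * x)"
    and "\<And>x. m x = m\<^sub>0 * exp (v * (- 4 * c\<^sub>2 * exp (- v * x) - 5 * x))"
    and "\<And>x. T x = 2 * a\<^sub>1 * v\<^sup>2 * exp (- v * x)"
    and "\<And>x t. u x t = exp (2 * v * x) * (A\<^sub>1 + A\<^sub>2 * t)"
  shows "solves_beam_equation EI m T u"
proof -
  define g where "g t = A\<^sub>1 + A\<^sub>2 * t" for t
  have u: "u = (\<lambda>x t. exp (2 * v * x) * g t)"
    using assms(7) by (simp add: g_def fun_eq_iff)
  have ux: "partial_x u = (\<lambda>x t. exp (2 * v * x) * (2 * v * g t))"
    unfolding u by (rule partial_x_exp)
  have uxx: "partial_x (partial_x u) = (\<lambda>x t. exp (2 * v * x) * (2 * v * (2 * v * g t)))"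
    unfolding ux by (rule partial_x_exp)
  have shift: "exp (- v * x) * exp (2 * v * x) = exp (v * x)" for x
    by (simp flip: exp_add)
  have moment: "(\<lambda>x t. EI x * partial_x (partial_x u) x t)
      = (\<lambda>x t. exp (v * x) * (4 * a\<^sub>1 * v\<^sup>2 * g t))"
    unfolding uxx assms(4) shift[symmetric] by (simp add: fun_eq_iff power2_eq_square)
  have moment_x: "partial_x (\<lambda>x t. EI x * partial_x (partial_x u) x t)
      = (\<lambda>x t. exp (v * x) * (v * (4 * a\<^sub>1 * v\<^sup>2 * g t)))"
    unfolding moment by (rule partial_x_exp)
  have moment_xx: "partial_x (partial_x (\<lambda>x t. EI x * partial_x (partial_x u) x t))
      = (\<lambda>x t. exp (v * x) * (v * (v * (4 * a\<^sub>1 * v\<^sup>2 * g t))))"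
    unfolding moment_x by (rule partial_x_exp)
  have axial: "(\<lambda>x t. T x * partial_x u x t)
      = (\<lambda>x t. exp (v * x) * (4 * a\<^sub>1 * v ^ 3 * g t))"
    unfolding ux assms(6) shift[symmetric]
    by (simp add: fun_eq_iff power2_eq_square power3_eq_cube)
  have axial_x: "partial_x (\<lambda>x t. T x * partial_x u x t)
      = (\<lambda>x t. exp (v * x) * (v * (4 * a\<^sub>1 * v ^ 3 * g t)))"
    unfolding axial by (rule partial_x_exp)
  have u_affine: "u = (\<lambda>x t. exp (2 * v * x) * (A\<^sub>1 + A\<^sub>2 * t))"
    using assms(7) by (simp add: fun_eq_iff)
  \<comment> \<open>The time derivative is written as an affine function of slope zero, so that the rule for
    affine functions applies to it as well.\<close>
  have ut: "partial_t u = (\<lambda>x t. exp (2 * v * x) * (A\<^sub>2 + 0 * t))"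
    unfolding u_affine partial_t_affine by simp
  have utt: "partial_t (partial_t u) = (\<lambda>x t. exp (2 * v * x) * 0)"
    unfolding ut by (rule partial_t_affine)
  have "has_partial_x u" unfolding u by (rule has_partial_x_exp)
  moreover have "has_partial_x (partial_x u)" unfolding ux by (rule has_partial_x_exp)
  moreover have "has_partial_x (\<lambda>x t. EI x * partial_x (partial_x u) x t)"
    unfolding moment by (rule has_partial_x_exp)
  moreover have "has_partial_x (partial_x (\<lambda>x t. EI x * partial_x (partial_x u) x t))"
    unfolding moment_x by (rule has_partial_x_exp)
  moreover have "has_partial_t u" unfolding u_affine by (rule has_partial_t_affine)
  moreover have "has_partial_t (partial_t u)" unfolding ut by (rule has_partial_t_affine)
  moreover have "has_partial_x (\<lambda>x t. T x * partial_x u x t)"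
    unfolding axial by (rule has_partial_x_exp)
  ultimately have "beam_derivatives_exist EI T u"
    unfolding beam_derivatives_exist_def by blast
  then show ?thesis
    unfolding solves_beam_equation_def moment_xx axial_x utt
    by (simp add: power2_eq_square power3_eq_cube)
qed

end
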